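(* Every graph $G$ without isolated vertices, with $m\ge1$ edges and spectral radius $\lambda$, satisfies $$t(G)\ \ge\ \frac13(\lambda+1)(\lambda^2-m).$$ Equality holds if and only if $G$ is a complete graph or a complete bipartite graph.
   Context: Graphs are finite and simple. The spectral radius of $G$ is the spectral radius of its adjacency matrix. $t(G)$ denotes the number of triangles of $G$. *)

theory Defs
  imports Complex_Main "Graph_Theory.Graph_Theory" "Jordan_Normal_Form.Spectral_Radius"
begin

text \<open>A finite simple graph is a \<open>Digraph.graph\<close>: a finite symmetric digraph without loops or
  multiple arcs. Every undirected edge corresponds to two opposite arcs, so edges are counted as
  unordered pairs of adjacent vertices.\<close>

definition undirected_edges :: "('a, 'b) pre_digraph \<Rightarrow> 'a set set" where
  "undirected_edges G = {{u, v} | u v. u \<rightarrow>\<^bsub>G\<^esub> v}"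

definition isolated_vertex :: "('a, 'b) pre_digraph \<Rightarrow> 'a \<Rightarrow> bool" where
  "isolated_vertex G v \<longleftrightarrow> v \<in> verts G \<and> \<not> (\<exists>w. v \<rightarrow>\<^bsub>G\<^esub> w)"

definition triangles :: "('a, 'b) pre_digraph \<Rightarrow> 'a set set" where
  "triangles G = {T. T \<subseteq> verts G \<and> card T = 3 \<and> (\<forall>u\<in>T. \<forall>v\<in>T. u \<noteq> v \<longrightarrow> u \<rightarrow>\<^bsub>G\<^esub> v)}"

text \<open>Matrices are indexed by initial segments of the naturals, so the adjacency matrix is taken
  with respect to an enumeration \<open>vs\<close> of the vertices. The entries are complex because
  \<open>spectral_radius\<close> is defined for complex matrices.\<close>

definition adjacency_matrix :: "('a, 'b) pre_digraph \<Rightarrow> 'a list \<Rightarrow> complex mat" where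
  "adjacency_matrix G vs =
     mat (length vs) (length vs) (\<lambda>(i, j). if vs ! i \<rightarrow>\<^bsub>G\<^esub> vs ! j then 1 else 0)"

definition is_complete :: "('a, 'b) pre_digraph \<Rightarrow> bool" where
  "is_complete G \<longleftrightarrow> (\<exists>n. complete_digraph n G)"

definition is_complete_bipartite :: "('a, 'b) pre_digraph \<Rightarrow> bool" where
  "is_complete_bipartite G \<longleftrightarrow> (\<exists>p q. p \<ge> 1 \<and> q \<ge> 1 \<and> complete_bipartite_digraph p q G)"

end

theory Submission
  imports Defs
begin

text \<open>Let \<open>x \<ge> 0\<close> satisfy \<open>A x \<ge> \<rho> x\<close> with maximal entry \<open>x c = 1\<close>. For an edge \<open>vw\<close>,
  \<open>\<Sum>x\<close> is at least the sum of \<open>x\<close> over \<open>N(v) \<union> N(w)\<close>, hence at least \<open>\<rho> x v + \<rho> x w\<close>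
  minus the sum over \<open>N(v) \<inter> N(w)\<close>. Adding this up over all edges gives
  \<open>(\<rho>\<^sup>2 - m) \<Sum>x \<le> \<Sum>\<^sub>u t(u) x u\<close>, where \<open>t(u)\<close> counts the triangles through \<open>u\<close>. The right-hand
  side is at most \<open>3t\<close> because \<open>x \<le> 1\<close>, and \<open>\<Sum>x \<ge> \<rho> + 1\<close> because the neighbours of \<open>c\<close>
  contribute at least \<open>\<rho>\<close>. In case of equality \<open>x\<close> is a positive eigenvector and every edge
  dominates the graph; if there is a triangle, then moreover every vertex with \<open>x u = 1\<close> is
  adjacent to all others, which forces \<open>x = 1\<close> everywhere.\<close>

text \<open>Edges and triangles are counted by ordered arcs: \<open>card (nbhd_arcs G u)\<close> is twice the number of
  triangles through \<open>u\<close>.\<close>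

definition nbhd :: "('a, 'b) pre_digraph \<Rightarrow> 'a \<Rightarrow> 'a set" where
  "nbhd G u = {v. u \<rightarrow>\<^bsub>G\<^esub> v}"

definition nbhd_arcs :: "('a, 'b) pre_digraph \<Rightarrow> 'a \<Rightarrow> ('a \<times> 'a) set" where
  "nbhd_arcs G u = {p \<in> arcs_ends G. fst p \<in> nbhd G u \<and> snd p \<in> nbhd G u}"

section \<open>Double counting of arcs and triangles\<close>

context graph
begin

lemma dominates_sym: "u \<rightarrow>\<^bsub>G\<^esub> v \<longleftrightarrow> v \<rightarrow>\<^bsub>G\<^esub> u"
  using sym_arcs by (auto simp: symmetric_def dest: symD)

lemma not_dominates_self: "\<not> u \<rightarrow>\<^bsub>G\<^esub> u"
  by (metis adj_not_same)

lemma dominates_verts: "u \<rightarrow>\<^bsub>G\<^esub> v \<Longrightarrow> u \<in> verts G \<and> v \<in> verts G"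
  by (auto simp: adj_in_verts)

lemma nbhd_subset: "nbhd G u \<subseteq> verts G"
  by (auto simp: nbhd_def adj_in_verts)

lemma finite_nbhd: "finite (nbhd G u)"
  using nbhd_subset finite_verts finite_subset by blast

lemma finite_arcs_ends: "finite (arcs_ends G)"
  by (simp add: arcs_ends_conv)

lemma finite_triangles: "finite (triangles G)"
  by (rule finite_subset[of _ "Pow (verts G)"]) (auto simp: triangles_def)

lemma arcs_ends_Sigma: "arcs_ends G = Sigma (verts G) (nbhd G)"
  by (auto simp: nbhd_def dominates_verts)

text \<open>Interchanging the sums, \<open>f u\<close> is collected once from every neighbour of
  \<open>u\<close>, because adjacency is symmetric.\<close>

lemma sum_nbhd_swap:
  fixes f :: "'a \<Rightarrow> real"
  shows "(\<Sum>v\<in>verts G. sum f (nbhd G v)) = (\<Sum>u\<in>verts G. real (card (nbhd G u)) * f u)"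
proof -
  have "(\<Sum>v\<in>verts G. sum f (nbhd G v)) = (\<Sum>v\<in>verts G. \<Sum>u\<in>{u\<in>verts G. v \<rightarrow>\<^bsub>G\<^esub> u}. f u)"
    by (intro sum.cong refl) (auto simp: nbhd_def dominates_verts)
  also have "\<dots> = (\<Sum>u\<in>verts G. \<Sum>v\<in>{v\<in>verts G. v \<rightarrow>\<^bsub>G\<^esub> u}. f u)"
    by (rule sum.swap_restrict) auto
  also have "\<dots> = (\<Sum>u\<in>verts G. real (card (nbhd G u)) * f u)"
  proof (intro sum.cong refl)
    fix u
    have "{v\<in>verts G. v \<rightarrow>\<^bsub>G\<^esub> u} = nbhd G u"
      using dominates_sym[of u] dominates_verts unfolding nbhd_def by blast
    then show "(\<Sum>v\<in>{v\<in>verts G. v \<rightarrow>\<^bsub>G\<^esub> u}. f u) = real (card (nbhd G u)) * f u" by simp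
  qed
  finally show ?thesis .
qed

lemma sum_arcs_fst:
  fixes f :: "'a \<Rightarrow> real"
  shows "(\<Sum>p\<in>arcs_ends G. f (fst p)) = (\<Sum>v\<in>verts G. real (card (nbhd G v)) * f v)"
  unfolding arcs_ends_Sigma
  by (subst sum.Sigma[symmetric, where g = "\<lambda>u v. f u", simplified split_def])
     (auto simp: finite_nbhd)

lemma sum_arcs_snd:
  fixes f :: "'a \<Rightarrow> real"
  shows "(\<Sum>p\<in>arcs_ends G. f (snd p)) = (\<Sum>p\<in>arcs_ends G. f (fst p))"
  by (rule sum.reindex_bij_witness[where i = prod.swap and j = prod.swap])
     (auto simp: dominates_sym)

text \<open>Both sides count, with weight \<open>x u\<close>, the pairs of an arc and a vertex
  \<open>u\<close> adjacent to its two ends.\<close>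

lemma sum_arcs_common_nbhd:
  fixes x :: "'a \<Rightarrow> real"
  shows "(\<Sum>p\<in>arcs_ends G. sum x (nbhd G (fst p) \<inter> nbhd G (snd p)))
       = (\<Sum>u\<in>verts G. real (card (nbhd_arcs G u)) * x u)"
proof -
  have "(\<Sum>p\<in>arcs_ends G. sum x (nbhd G (fst p) \<inter> nbhd G (snd p)))
      = (\<Sum>p\<in>arcs_ends G. \<Sum>u\<in>{u\<in>verts G. fst p \<in> nbhd G u \<and> snd p \<in> nbhd G u}. x u)"
    using dominates_sym dominates_verts
    by (intro sum.cong refl) (auto simp: nbhd_def)
  also have "\<dots> = (\<Sum>u\<in>verts G. \<Sum>p\<in>{p\<in>arcs_ends G. fst p \<in> nbhd G u \<and> snd p \<in> nbhd G u}. x u)"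
    by (rule sum.swap_restrict) (auto simp: finite_arcs_ends)
  finally show ?thesis by (simp add: nbhd_arcs_def)
qed

lemma card_arcs_ends: "card (arcs_ends G) = 2 * card (undirected_edges G)"
proof -
  let ?f = "\<lambda>p. {fst p, snd p}"
  have im: "?f ` arcs_ends G = undirected_edges G"
    by (force simp: undirected_edges_def)
  have "card (arcs_ends G) = (\<Sum>e\<in>undirected_edges G. card {p\<in>arcs_ends G. ?f p = e})"
    using sum.group[of "arcs_ends G" "undirected_edges G" ?f "\<lambda>_. 1::nat"]
      finite_arcs_ends finite_imageI[OF finite_arcs_ends, of ?f]
    unfolding im by simp
  also have "\<dots> = (\<Sum>e\<in>undirected_edges G. 2)"
  proof (intro sum.cong refl)
    fix e assume "e \<in> undirected_edges G"
    then obtain u v where e: "e = {u, v}" and uv: "u \<rightarrow>\<^bsub>G\<^esub> v" by (auto simp: undirected_edges_def)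
    then have "{p\<in>arcs_ends G. ?f p = e} = {(u, v), (v, u)}"
      using dominates_sym[of u v] by (auto simp: doubleton_eq_iff)
    moreover have "u \<noteq> v" using uv not_dominates_self by auto
    ultimately show "card {p\<in>arcs_ends G. ?f p = e} = 2" by simp
  qed
  finally show ?thesis by simp
qed

text \<open>Each triangle arises from the six orderings of its vertices as a triple
  \<open>(u, v, w)\<close> with \<open>(v, w)\<close> in \<open>nbhd_arcs G u\<close>.\<close>

lemma sum_card_nbhd_arcs: "(\<Sum>u\<in>verts G. card (nbhd_arcs G u)) = 6 * card (triangles G)"
proof -
  let ?P = "Sigma (verts G) (nbhd_arcs G)"
  let ?f = "\<lambda>(u, v, w). {u, v, w}"
  have fin_na: "finite (nbhd_arcs G u)" for u
    using finite_arcs_ends by (simp add: nbhd_arcs_def)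
  have fin: "finite ?P" using fin_na by auto
  have P: "(u, v, w) \<in> ?P \<longleftrightarrow> u \<rightarrow>\<^bsub>G\<^esub> v \<and> u \<rightarrow>\<^bsub>G\<^esub> w \<and> v \<rightarrow>\<^bsub>G\<^esub> w" for u v w
    using dominates_verts by (auto simp: nbhd_arcs_def nbhd_def)
  have im: "?f ` ?P \<subseteq> triangles G"
  proof
    fix T assume "T \<in> ?f ` ?P"
    then obtain p where p: "p \<in> ?P" "T = ?f p" by blast
    obtain u v w where uvw: "p = (u, v, w)" by (cases p) auto
    have T: "T = {u, v, w}" and a: "u \<rightarrow>\<^bsub>G\<^esub> v" "u \<rightarrow>\<^bsub>G\<^esub> w" "v \<rightarrow>\<^bsub>G\<^esub> w"
      using p uvw P[of u v w] by simp_all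
    then have "u \<noteq> v" "u \<noteq> w" "v \<noteq> w" using not_dominates_self by auto
    moreover have "v \<rightarrow>\<^bsub>G\<^esub> u" "w \<rightarrow>\<^bsub>G\<^esub> u" "w \<rightarrow>\<^bsub>G\<^esub> v"
      "u \<in> verts G" "v \<in> verts G" "w \<in> verts G"
      using a dominates_verts dominates_sym by blast+
    ultimately show "T \<in> triangles G" using a T by (simp add: triangles_def)
  qed
  have "(\<Sum>u\<in>verts G. card (nbhd_arcs G u)) = card ?P"
    using fin_na by (simp add: card_SigmaI)
  also have "\<dots> = (\<Sum>T\<in>triangles G. card {p\<in>?P. ?f p = T})"
    using sum.group[OF fin finite_triangles im, of "\<lambda>_. 1::nat"] by simp
  also have "\<dots> = (\<Sum>T\<in>triangles G. 6)"
  proof (intro sum.cong refl)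
    fix T assume T: "T \<in> triangles G"
    then obtain a b c where abc: "T = {a, b, c}" "a \<noteq> b" "a \<noteq> c" "b \<noteq> c"
      by (auto simp: triangles_def card_3_iff)
    have adj: "u \<in> T \<Longrightarrow> v \<in> T \<Longrightarrow> u \<noteq> v \<Longrightarrow> u \<rightarrow>\<^bsub>G\<^esub> v" for u v
      using T by (auto simp: triangles_def)
    have "{p\<in>?P. ?f p = T} = {(a,b,c), (a,c,b), (b,a,c), (b,c,a), (c,a,b), (c,b,a)}" (is "?L = ?R")
    proof (intro equalityI subsetI)
      fix p assume p: "p \<in> ?L"
      obtain u v w where uvw: "p = (u, v, w)" by (cases p) auto
      have "u \<noteq> v" "u \<noteq> w" "v \<noteq> w" using p P[of u v w] uvw not_dominates_self by auto
      moreover have "{u, v, w} = {a, b, c}" using p uvw abc by simp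
      then have "u \<in> {a, b, c}" "v \<in> {a, b, c}" "w \<in> {a, b, c}" by blast+
      ultimately show "p \<in> ?R" using uvw by auto
    next
      fix p assume "p \<in> ?R"
      then show "p \<in> ?L" using abc adj P by (elim insertE) auto
    qed
    then show "card {p\<in>?P. ?f p = T} = 6" using abc by simp
  qed
  finally show ?thesis by simp
qed

text \<open>Inclusion-exclusion for the neighbourhoods of two adjacent vertices, summed over all
  arcs; each edge is met in both directions. \<open>q\<close> measures how far \<open>x\<close> is
  from being an eigenfunction for \<open>\<rho>\<close>. An exact identity, rather than an estimate,
  keeps every error term visible for the equality case.\<close>

lemma weighted_triangle_identity:
  fixes x :: "'a \<Rightarrow> real" and \<rho> :: real
  defines "q \<equiv> \<lambda>v. sum x (nbhd G v) - \<rho> * x v"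
  shows "(\<Sum>u\<in>verts G. real (card (nbhd_arcs G u)) * x u)
    = 2 * (\<rho>\<^sup>2 - real (card (undirected_edges G))) * sum x (verts G)
      + 2 * \<rho> * sum q (verts G) + 2 * (\<Sum>v\<in>verts G. real (card (nbhd G v)) * q v)
      + (\<Sum>p\<in>arcs_ends G. sum x (verts G - (nbhd G (fst p) \<union> nbhd G (snd p))))"
proof -
  let ?S = "sum x (verts G)" and ?n = "\<lambda>v. sum x (nbhd G v)"
  let ?d = "\<lambda>v. real (card (nbhd G v))"
  have incl: "?S + sum x (nbhd G v \<inter> nbhd G w)
      = ?n v + ?n w + sum x (verts G - (nbhd G v \<union> nbhd G w))" for v w
  proof -
    have "?S = sum x (nbhd G v \<union> nbhd G w) + sum x (verts G - (nbhd G v \<union> nbhd G w))"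
      using sum.subset_diff[where A = "verts G" and B = "nbhd G v \<union> nbhd G w" and g = x]
        nbhd_subset[of v] nbhd_subset[of w] by (simp add: add.commute)
    then show ?thesis using sum.union_inter[where A = "nbhd G v" and B = "nbhd G w" and g = x] finite_nbhd by simp
  qed
  have "(\<Sum>p\<in>arcs_ends G. ?S + sum x (nbhd G (fst p) \<inter> nbhd G (snd p)))
      = (\<Sum>p\<in>arcs_ends G. ?n (fst p) + ?n (snd p)
           + sum x (verts G - (nbhd G (fst p) \<union> nbhd G (snd p))))"
    using incl by simp
  then have 1: "2 * real (card (undirected_edges G)) * ?S
        + (\<Sum>u\<in>verts G. real (card (nbhd_arcs G u)) * x u)
      = 2 * (\<Sum>v\<in>verts G. ?d v * ?n v)
        + (\<Sum>p\<in>arcs_ends G. sum x (verts G - (nbhd G (fst p) \<union> nbhd G (snd p))))"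
    by (simp add: sum.distrib sum_arcs_common_nbhd card_arcs_ends
        sum_arcs_snd[of ?n] sum_arcs_fst[of ?n])
  \<comment> \<open>This substitution is made twice: under the degree weights, and again after
    \<open>sum_nbhd_swap\<close> has turned the degree-weighted sum of \<open>x\<close> back into
    neighbourhood sums. The two rounds produce \<open>\<rho>\<^sup>2\<close>.\<close>
  have n: "?n v = \<rho> * x v + q v" for v by (simp add: q_def)
  have "(\<Sum>v\<in>verts G. ?d v * ?n v)
      = \<rho> * (\<Sum>v\<in>verts G. ?d v * x v) + (\<Sum>v\<in>verts G. ?d v * q v)"
    unfolding n by (simp add: algebra_simps sum.distrib sum_distrib_left)
  also have "(\<Sum>v\<in>verts G. ?d v * x v) = \<rho> * ?S + sum q (verts G)"
    unfolding sum_nbhd_swap[symmetric] n by (simp add: sum.distrib sum_distrib_left)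
  finally show ?thesis using 1 by (simp add: algebra_simps power2_eq_square)
qed

section \<open>The inequality for a normalised subharmonic weight\<close>

context
  fixes x :: "'a \<Rightarrow> real" and \<rho> :: real and c :: 'a
  assumes nonneg: "\<And>v. v \<in> verts G \<Longrightarrow> 0 \<le> x v"
    and le_1: "\<And>v. v \<in> verts G \<Longrightarrow> x v \<le> 1"
    and c: "c \<in> verts G" "x c = 1"
    and subharmonic: "\<And>v. v \<in> verts G \<Longrightarrow> \<rho> * x v \<le> sum x (nbhd G v)"
    and \<rho>_nonneg: "0 \<le> \<rho>"
    and \<rho>_ge: "real (card (undirected_edges G)) \<le> \<rho>\<^sup>2"
begin

abbreviation (input) "defect v \<equiv> sum x (nbhd G v) - \<rho> * x v"
abbreviation (input) "excess \<equiv> \<rho>\<^sup>2 - real (card (undirected_edges G))"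
abbreviation (input) "far p \<equiv> verts G - (nbhd G (fst p) \<union> nbhd G (snd p))"

text \<open>Twice the slack in the bound, split by source: triangle weights below 1, total weight
  above \<open>\<rho> + 1\<close>, failure of harmonicity (two terms), and vertices not dominated by
  an edge. As all terms are nonnegative, both the inequality and its equality case can be read
  off.\<close>

lemma triangle_deficit:
  "6 * real (card (triangles G)) - 2 * (\<rho> + 1) * excess
    = (\<Sum>u\<in>verts G. real (card (nbhd_arcs G u)) * (1 - x u))
      + 2 * excess * (sum x (verts G) - \<rho> - 1)
      + 2 * \<rho> * sum defect (verts G)
      + 2 * (\<Sum>v\<in>verts G. real (card (nbhd G v)) * defect v)
      + (\<Sum>p\<in>arcs_ends G. sum x (far p))"
proof -
  have "6 * real (card (triangles G)) = (\<Sum>u\<in>verts G. real (card (nbhd_arcs G u)))"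
    using sum_card_nbhd_arcs by (metis of_nat_mult of_nat_numeral of_nat_sum)
  then have "(\<Sum>u\<in>verts G. real (card (nbhd_arcs G u)) * (1 - x u))
      = 6 * real (card (triangles G)) - (\<Sum>u\<in>verts G. real (card (nbhd_arcs G u)) * x u)"
    by (simp add: right_diff_distrib sum_subtractf)
  \<comment> \<open>Pure algebra over variables, so that the sums are not expanded: \<open>S\<close>
    stands for the total weight, \<open>Q\<close> and \<open>D\<close> for the plain and the
    degree-weighted defect sums, \<open>R\<close> for the sum over far vertices.\<close>
  moreover have "a - 2 * (r + 1) * e = (a - (2 * e * S + 2 * r * Q + 2 * D + R))
      + 2 * e * (S - r - 1) + 2 * r * Q + 2 * D + R" for a r e S Q D R :: real
    by (simp add: algebra_simps)
  ultimately show ?thesis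
    by (simp only: weighted_triangle_identity[of x \<rho>])
qed

lemma sum_verts_ge: "\<rho> + 1 \<le> sum x (verts G)"
proof -
  have "\<rho> + 1 \<le> sum x (nbhd G c) + x c" using subharmonic[OF c(1)] c(2) by simp
  also have "\<dots> = sum x (insert c (nbhd G c))"
    using finite_nbhd[of c] not_dominates_self[of c] by (simp add: nbhd_def)
  also have "\<dots> \<le> sum x (verts G)"
    using nbhd_subset[of c] c nonneg by (intro sum_mono2) auto
  finally show ?thesis .
qed

lemma deficit_terms_nonneg:
  "0 \<le> (\<Sum>u\<in>verts G. real (card (nbhd_arcs G u)) * (1 - x u))"
  "0 \<le> 2 * excess * (sum x (verts G) - \<rho> - 1)"
  "0 \<le> 2 * \<rho> * sum defect (verts G)"
  "0 \<le> 2 * (\<Sum>v\<in>verts G. real (card (nbhd G v)) * defect v)"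
  "0 \<le> (\<Sum>p\<in>arcs_ends G. sum x (far p))"
proof -
  show "0 \<le> 2 * excess * (sum x (verts G) - \<rho> - 1)"
    using sum_verts_ge \<rho>_ge by simp
  show "0 \<le> 2 * \<rho> * sum defect (verts G)"
    using subharmonic \<rho>_nonneg by (simp add: sum_nonneg)
  show "0 \<le> (\<Sum>u\<in>verts G. real (card (nbhd_arcs G u)) * (1 - x u))"
    using le_1 by (simp add: sum_nonneg)
  show "0 \<le> 2 * (\<Sum>v\<in>verts G. real (card (nbhd G v)) * defect v)"
    using subharmonic by (simp add: sum_nonneg)
  show "0 \<le> (\<Sum>p\<in>arcs_ends G. sum x (far p))"
    using nonneg by (intro sum_nonneg) auto
qed

lemma card_triangles_ge: "(\<rho> + 1) * excess \<le> 3 * real (card (triangles G))"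
  using triangle_deficit deficit_terms_nonneg by linarith

section \<open>Equality: from vanishing slack to the structure of the graph\<close>

context
  assumes eq: "(\<rho> + 1) * excess = 3 * real (card (triangles G))"
    and no_isolated: "\<And>v. v \<in> verts G \<Longrightarrow> nbhd G v \<noteq> {}"
    and edges_pos: "0 < card (undirected_edges G)"
begin

text \<open>\<open>eq\<close> makes the left side of \<open>triangle_deficit\<close> zero, so each
  nonnegative term on the right vanishes.\<close>

lemma deficit_terms_eq_0:
  "(\<Sum>u\<in>verts G. real (card (nbhd_arcs G u)) * (1 - x u)) = 0"
  "excess * (sum x (verts G) - \<rho> - 1) = 0"
  "(\<Sum>v\<in>verts G. real (card (nbhd G v)) * defect v) = 0"
  "(\<Sum>p\<in>arcs_ends G. sum x (far p)) = 0"
  using triangle_deficit deficit_terms_nonneg eq by linarith+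

lemma \<rho>_pos: "0 < \<rho>"
  using \<rho>_ge edges_pos \<rho>_nonneg by (cases "\<rho> = 0") auto

text \<open>The degree-weighted defects are nonnegative with sum 0, and no degree is 0, so every
  defect is 0.\<close>

lemma harmonic: "v \<in> verts G \<Longrightarrow> sum x (nbhd G v) = \<rho> * x v"
proof -
  assume v: "v \<in> verts G"
  have "real (card (nbhd G v)) * defect v = 0"
    using sum_nonneg_0[OF finite_verts _ deficit_terms_eq_0(3) v] subharmonic by simp
  then show ?thesis using no_isolated[OF v] finite_nbhd by simp
qed

lemma far_eq_0: "v \<rightarrow>\<^bsub>G\<^esub> w \<Longrightarrow> u \<in> verts G \<Longrightarrow> \<not> v \<rightarrow>\<^bsub>G\<^esub> u \<Longrightarrow> \<not> w \<rightarrow>\<^bsub>G\<^esub> u \<Longrightarrow> x u = 0"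
proof -
  assume a: "v \<rightarrow>\<^bsub>G\<^esub> w" "u \<in> verts G" "\<not> v \<rightarrow>\<^bsub>G\<^esub> u" "\<not> w \<rightarrow>\<^bsub>G\<^esub> u"
  have "sum x (far (v, w)) = 0"
    by (rule sum_nonneg_0[OF finite_arcs_ends _ deficit_terms_eq_0(4) a(1)])
       (auto intro: sum_nonneg nonneg)
  then show ?thesis
    using sum_nonneg_0[of "far (v, w)" x u] nonneg a by (auto simp: nbhd_def)
qed

lemma x_pos_adj: "u \<rightarrow>\<^bsub>G\<^esub> v \<Longrightarrow> 0 < x u \<Longrightarrow> 0 < x v"
proof -
  assume uv: "u \<rightarrow>\<^bsub>G\<^esub> v" and u: "0 < x u"
  have "x u \<le> sum x (nbhd G v)"
  proof (rule member_le_sum)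
    show "u \<in> nbhd G v" using uv dominates_sym by (simp add: nbhd_def)
  qed (use nbhd_subset nonneg finite_nbhd in auto)
  also have "\<dots> = \<rho> * x v" using harmonic uv dominates_verts by blast
  finally show ?thesis using u \<rho>_pos by (metis less_le_trans zero_less_mult_pos)
qed

text \<open>Since \<open>x c\<close> is not 0, any edge at \<open>v\<close> must dominate
  \<open>c\<close>. Hence \<open>c\<close> is within distance two of \<open>v\<close>, and
  positivity spreads from \<open>c\<close> along edges.\<close>

lemma x_pos: "v \<in> verts G \<Longrightarrow> 0 < x v"
proof -
  assume v: "v \<in> verts G"
  then obtain w where vw: "v \<rightarrow>\<^bsub>G\<^esub> w" using no_isolated by (auto simp: nbhd_def)
  have "v \<rightarrow>\<^bsub>G\<^esub> c \<or> w \<rightarrow>\<^bsub>G\<^esub> c" using far_eq_0[OF vw c(1)] c(2) by auto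
  moreover have "0 < x c" using c(2) by simp
  ultimately show ?thesis using x_pos_adj vw dominates_sym by blast
qed

lemma edge_dominating: "v \<rightarrow>\<^bsub>G\<^esub> w \<Longrightarrow> u \<in> verts G \<Longrightarrow> v \<rightarrow>\<^bsub>G\<^esub> u \<or> w \<rightarrow>\<^bsub>G\<^esub> u"
  using far_eq_0 x_pos by fastforce

text \<open>The sides are the neighbourhoods of the two ends of an arbitrary edge: they cover the
  graph because the edge dominates it, and they are disjoint because there is no triangle.\<close>

lemma triangle_free_imp_complete_bipartite:
  assumes "\<And>u v w. u \<rightarrow>\<^bsub>G\<^esub> v \<Longrightarrow> v \<rightarrow>\<^bsub>G\<^esub> w \<Longrightarrow> \<not> u \<rightarrow>\<^bsub>G\<^esub> w"
  shows "is_complete_bipartite G"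
proof -
  obtain v w where vw: "v \<rightarrow>\<^bsub>G\<^esub> w" using no_isolated[OF c(1)] by (auto simp: nbhd_def)
  let ?U = "nbhd G w" and ?V = "nbhd G v"
  have U: "verts G = ?U \<union> ?V" "?U \<inter> ?V = {}"
    using edge_dominating[OF vw] assms[OF vw] nbhd_subset by (auto simp: nbhd_def)
  \<comment> \<open>\<open>b\<close> is adjacent to \<open>v\<close>, hence not to \<open>w\<close>;
    the edge between \<open>w\<close> and \<open>a\<close> dominates \<open>b\<close>, so
    \<open>a\<close> must be adjacent to \<open>b\<close>.\<close>
  have cross: "a \<rightarrow>\<^bsub>G\<^esub> b" if "a \<in> ?U" "b \<in> ?V" for a b
  proof -
    have "w \<rightarrow>\<^bsub>G\<^esub> a" "\<not> w \<rightarrow>\<^bsub>G\<^esub> b" "b \<in> verts G"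
      using that U(2) nbhd_subset by (auto simp: nbhd_def)
    then show ?thesis using edge_dominating by blast
  qed
  have inner: "\<not> a \<rightarrow>\<^bsub>G\<^esub> b" if "a \<in> nbhd G y" "b \<in> nbhd G y" for a b y
    using that assms by (auto simp: nbhd_def)
  have "a \<rightarrow>\<^bsub>G\<^esub> b \<longleftrightarrow> (a, b) \<in> ?U \<times> ?V \<union> ?V \<times> ?U" for a b
    using U(1) cross[of a b] cross[of b a] inner[of a _ b] dominates_sym[of a b]
      dominates_verts[of a b] by blast
  then have arcs: "arcs_ends G = ?U \<times> ?V \<union> ?V \<times> ?U" by auto
  have "card ?U \<ge> 1" "card ?V \<ge> 1"
    using finite_nbhd no_isolated dominates_verts[OF vw] by (auto simp: card_gt_0_iff Suc_le_eq)
  then show ?thesis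
    unfolding is_complete_bipartite_def complete_bipartite_digraph_def
    using U arcs graph_axioms by blast
qed

lemma extremal: "is_complete G \<or> is_complete_bipartite G"
proof (cases "\<exists>u v w. u \<rightarrow>\<^bsub>G\<^esub> v \<and> v \<rightarrow>\<^bsub>G\<^esub> w \<and> u \<rightarrow>\<^bsub>G\<^esub> w")
  case False
  then show ?thesis using triangle_free_imp_complete_bipartite by blast
next
  case True
  then obtain u1 v1 w1 where tri: "u1 \<rightarrow>\<^bsub>G\<^esub> v1" "v1 \<rightarrow>\<^bsub>G\<^esub> w1" "u1 \<rightarrow>\<^bsub>G\<^esub> w1" by blast
  \<comment> \<open>A vertex on a triangle has a positive coefficient in the first vanishing sum,
    which forces weight 1.\<close>
  have x_1: "x u = 1" if "u \<rightarrow>\<^bsub>G\<^esub> v" "v \<rightarrow>\<^bsub>G\<^esub> w" "u \<rightarrow>\<^bsub>G\<^esub> w" for u v w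
  proof -
    have "(v, w) \<in> nbhd_arcs G u" using that by (auto simp: nbhd_arcs_def nbhd_def)
    then have "card (nbhd_arcs G u) \<noteq> 0"
      using finite_arcs_ends by (auto simp: nbhd_arcs_def)
    moreover have "real (card (nbhd_arcs G u)) * (1 - x u) = 0"
      using sum_nonneg_0[OF finite_verts _ deficit_terms_eq_0(1), of u] le_1 that(1) dominates_verts
      by simp
    ultimately show ?thesis by simp
  qed
  have "triangles G \<noteq> {}"
  proof -
    have "{u1, v1, w1} \<in> triangles G"
    proof -
      have "u1 \<noteq> v1" "v1 \<noteq> w1" "u1 \<noteq> w1" using tri not_dominates_self by auto
      with tri show ?thesis
        using dominates_sym dominates_verts by (auto simp: triangles_def)
    qed
    then show ?thesis by blast
  qed
  \<comment> \<open>A triangle makes the right side of \<open>eq\<close> positive, so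
    \<open>excess\<close> is nonzero and the second vanishing term fixes the total weight.\<close>
  then have "excess \<noteq> 0" using eq finite_triangles by auto
  then have S: "sum x (verts G) = \<rho> + 1" using deficit_terms_eq_0(2) by simp
  \<comment> \<open>\<open>y\<close> and its neighbours already carry the whole weight
    \<open>\<rho> + 1\<close>; a further vertex \<open>u\<close> would add a positive
    amount.\<close>
  have dom: "y \<rightarrow>\<^bsub>G\<^esub> u" if y: "y \<in> verts G" "x y = 1" and u: "u \<in> verts G" "u \<noteq> y" for y u
  proof (rule ccontr)
    assume n: "\<not> y \<rightarrow>\<^bsub>G\<^esub> u"
    have "sum x (insert u (insert y (nbhd G y))) \<le> sum x (verts G)"
      using nbhd_subset y u nonneg by (intro sum_mono2) auto
    moreover have "sum x (insert u (insert y (nbhd G y))) = x u + (x y + \<rho> * x y)"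
      using finite_nbhd not_dominates_self harmonic[OF y(1)] u n
      by (subst sum.insert; (subst sum.insert)?) (auto simp: nbhd_def)
    ultimately show False using S y(2) x_pos[OF u(1)] by simp
  qed
  \<comment> \<open>For \<open>u\<close> off the given triangle, \<open>u1\<close> and
    \<open>v1\<close> have weight 1 and so are adjacent to \<open>u\<close>; thus \<open>u\<close>
    lies on a triangle as well.\<close>
  have all_1: "x u = 1" if u: "u \<in> verts G" for u
  proof (cases "u \<in> {u1, v1, w1}")
    case True
    then show ?thesis using tri x_1 dominates_sym by blast
  next
    case False
    have "x u1 = 1" "x v1 = 1" using tri x_1 dominates_sym by blast+
    then have "u1 \<rightarrow>\<^bsub>G\<^esub> u" "v1 \<rightarrow>\<^bsub>G\<^esub> u"
      using dom[of u1 u] dom[of v1 u] u False dominates_verts[OF tri(1)] by simp_all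
    then show ?thesis using x_1[of u u1 v1] tri dominates_sym by blast
  qed
  have "arcs_ends G = {(u, v). (u, v) \<in> verts G \<times> verts G \<and> u \<noteq> v}"
    using dom[OF _ all_1] dominates_verts not_dominates_self by blast
  then show ?thesis
    unfolding is_complete_def complete_digraph_def using graph_axioms by blast
qed

end

end

section \<open>Eigenvalues of the adjacency matrix via functions on the vertices\<close>

context
  fixes vs :: "'a list"
  assumes distinct_vs: "distinct vs" and set_vs: "set vs = verts G"
begin

abbreviation (input) "index \<equiv> inv_into {..<length vs} ((!) vs)"

lemma bij_nth: "bij_betw ((!) vs) {..<length vs} (verts G)"
  by (rule bij_betw_nth[OF distinct_vs _ set_vs[symmetric]]) simp

lemma nth_index: "v \<in> verts G \<Longrightarrow> vs ! index v = v"
  using bij_nth by (auto simp: bij_betw_def intro: f_inv_into_f)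

lemma index_nth: "i < length vs \<Longrightarrow> index (vs ! i) = i"
  using bij_nth by (auto simp: bij_betw_def inv_into_f_f)

lemma index_less: "v \<in> verts G \<Longrightarrow> index v < length vs"
  using bij_nth inv_into_into[of v "(!) vs" "{..<length vs}"] by (auto simp: bij_betw_def)

lemma adjacency_matrix_carrier: "adjacency_matrix G vs \<in> carrier_mat (length vs) (length vs)"
  by (simp add: adjacency_matrix_def)

text \<open>Reindexing along \<open>vs\<close> turns row \<open>i\<close> into a sum over vertices,
  in which the 0/1 entries pick out the neighbours.\<close>

lemma adjacency_matrix_mult_vec:
  assumes "i < length vs"
  shows "(adjacency_matrix G vs *\<^sub>v vec (length vs) (\<lambda>j. f (vs ! j))) $ i = sum f (nbhd G (vs ! i))"
proof -
  have "(adjacency_matrix G vs *\<^sub>v vec (length vs) (\<lambda>j. f (vs ! j))) $ i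
      = (\<Sum>j<length vs. (if vs ! i \<rightarrow>\<^bsub>G\<^esub> vs ! j then 1 else 0) * f (vs ! j))"
    using assms by (simp add: adjacency_matrix_def scalar_prod_def lessThan_atLeast0)
  also have "\<dots> = (\<Sum>v\<in>verts G. (if vs ! i \<rightarrow>\<^bsub>G\<^esub> v then 1 else 0) * f v)"
    by (rule sum.reindex_bij_betw[OF bij_nth])
  also have "\<dots> = (\<Sum>v\<in>verts G. if v \<in> nbhd G (vs ! i) then f v else 0)"
    by (intro sum.cong) (auto simp: nbhd_def)
  also have "\<dots> = sum f (nbhd G (vs ! i))"
    using nbhd_subset[of "vs ! i"] finite_verts
    by (simp add: sum.If_cases Int_absorb1 Int_commute)
  finally show ?thesis .
qed

text \<open>Replaces vectors indexed by positions in \<open>vs\<close> by functions on vertices. A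
  nonzero value is demanded inside \<open>verts G\<close>, since values elsewhere are arbitrary and
  never enter the sums.\<close>

lemma eigenvalue_adjacency_matrix_iff:
  "eigenvalue (adjacency_matrix G vs) k
    \<longleftrightarrow> (\<exists>f. (\<exists>v\<in>verts G. f v \<noteq> 0) \<and> (\<forall>v\<in>verts G. sum f (nbhd G v) = k * f v))"
proof
  assume "eigenvalue (adjacency_matrix G vs) k"
  then obtain z where z: "z \<in> carrier_vec (length vs)" "z \<noteq> 0\<^sub>v (length vs)"
      "adjacency_matrix G vs *\<^sub>v z = k \<cdot>\<^sub>v z"
    by (auto simp: eigenvalue_def eigenvector_def adjacency_matrix_def)
  let ?f = "\<lambda>v. z $ index v"
  have zf: "z = vec (length vs) (\<lambda>j. ?f (vs ! j))"
    using z(1) by (intro eq_vecI) (auto simp: index_nth)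
  obtain i where i: "i < length vs" "z $ i \<noteq> 0"
    using z(1,2) by (metis carrier_vecD eq_vecI index_zero_vec(1,2))
  have "?f (vs ! i) \<noteq> 0" "vs ! i \<in> verts G"
    using i index_nth[OF i(1)] nth_mem[OF i(1)] set_vs by simp_all
  moreover have "sum ?f (nbhd G v) = k * ?f v" if v: "v \<in> verts G" for v
  proof -
    have "sum ?f (nbhd G (vs ! index v)) = (k \<cdot>\<^sub>v z) $ index v"
      using adjacency_matrix_mult_vec[OF index_less[OF v], of ?f] zf z(3) by metis
    then show ?thesis using nth_index[OF v] index_less[OF v] z(1) by simp
  qed
  ultimately show "\<exists>f. (\<exists>v\<in>verts G. f v \<noteq> 0) \<and> (\<forall>v\<in>verts G. sum f (nbhd G v) = k * f v)"
    by (intro exI[of _ ?f] conjI bexI[of _ "vs ! i"] ballI)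
next
  assume "\<exists>f. (\<exists>v\<in>verts G. f v \<noteq> 0) \<and> (\<forall>v\<in>verts G. sum f (nbhd G v) = k * f v)"
  then obtain f v where f: "v \<in> verts G" "f v \<noteq> 0" "\<And>v. v \<in> verts G \<Longrightarrow> sum f (nbhd G v) = k * f v"
    by blast
  let ?z = "vec (length vs) (\<lambda>j. f (vs ! j))"
  have "?z $ index v \<noteq> 0" using f(1,2) by (simp add: index_less nth_index)
  then have "?z \<noteq> 0\<^sub>v (length vs)" using index_less[OF f(1)] by (metis index_zero_vec(1))
  moreover have "adjacency_matrix G vs *\<^sub>v ?z = k \<cdot>\<^sub>v ?z"
  proof (rule eq_vecI)
    fix i assume "i < dim_vec (k \<cdot>\<^sub>v ?z)"
    then have i: "i < length vs" by simp
    then have "vs ! i \<in> verts G" using set_vs nth_mem by blast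
    then show "(adjacency_matrix G vs *\<^sub>v ?z) $ i = (k \<cdot>\<^sub>v ?z) $ i"
      using adjacency_matrix_mult_vec[OF i, of f] f(3) i by simp
  qed (simp add: adjacency_matrix_def)
  ultimately show "eigenvalue (adjacency_matrix G vs) k"
    unfolding eigenvalue_def eigenvector_def by (intro exI[of _ ?z]) (simp add: adjacency_matrix_def)
qed

text \<open>Serves to bound the spectral radius from below by exhibiting a real eigenfunction, which
  is read as a complex one.\<close>

lemma abs_eigenvalue_le_spectral_radius:
  fixes f :: "'a \<Rightarrow> real"
  assumes "v \<in> verts G" "f v \<noteq> 0" "\<And>v. v \<in> verts G \<Longrightarrow> sum f (nbhd G v) = k * f v"
  shows "\<bar>k\<bar> \<le> spectral_radius (adjacency_matrix G vs)"
proof -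
  have "(\<Sum>u\<in>nbhd G v. complex_of_real (f u)) = of_real k * of_real (f v)" if "v \<in> verts G" for v
    using assms(3)[OF that] by (metis of_real_mult of_real_sum)
  then have "eigenvalue (adjacency_matrix G vs) (of_real k)"
    unfolding eigenvalue_adjacency_matrix_iff using assms(1,2)
    by (intro exI[of _ "\<lambda>v. of_real (f v)"]) auto
  then have "\<bar>k\<bar> \<in> norm ` spectrum (adjacency_matrix G vs)"
    by (force simp: spectrum_def)
  moreover have "0 < length vs" using assms(1) set_vs by force
  ultimately show ?thesis
    using spectral_radius_mem_max(2)[OF adjacency_matrix_carrier] by blast
qed

text \<open>Taking absolute values in an eigenvector only yields a subharmonic function. This is enough
  for the inequality and spares the Perron--Frobenius theorem.\<close>

lemma obtain_subharmonic:
  assumes "verts G \<noteq> {}"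
  obtains x c where "\<And>v. v \<in> verts G \<Longrightarrow> 0 \<le> x v" "\<And>v. v \<in> verts G \<Longrightarrow> x v \<le> 1"
    "c \<in> verts G" "x c = 1"
    "\<And>v. v \<in> verts G \<Longrightarrow> spectral_radius (adjacency_matrix G vs) * x v \<le> sum x (nbhd G v)"
    "0 \<le> spectral_radius (adjacency_matrix G vs)"
proof -
  have "0 < length vs" using assms set_vs by force
  then obtain k where k: "eigenvalue (adjacency_matrix G vs) k"
      "spectral_radius (adjacency_matrix G vs) = norm k"
    using spectral_radius_mem_max(1)[OF adjacency_matrix_carrier] by (auto simp: spectrum_def)
  then obtain f w where f: "w \<in> verts G" "f w \<noteq> 0"
      "\<And>v. v \<in> verts G \<Longrightarrow> sum f (nbhd G v) = k * f v"
    unfolding eigenvalue_adjacency_matrix_iff by blast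
  \<comment> \<open>Dividing by the largest modulus makes the maximal entry 1, attained at
    \<open>c\<close>.\<close>
  define M where "M = Max ((\<lambda>v. norm (f v)) ` verts G)"
  have M_ge: "norm (f v) \<le> M" if "v \<in> verts G" for v
    using that by (auto simp: M_def)
  have "M \<in> (\<lambda>v. norm (f v)) ` verts G"
    unfolding M_def using assms by (intro Max_in) auto
  then obtain c where c: "c \<in> verts G" "norm (f c) = M" by auto
  have M: "0 < M" using M_ge[OF f(1)] f(2) by (meson less_le_trans zero_less_norm_iff)
  show ?thesis
  proof (rule that[of "\<lambda>v. norm (f v) / M" c])
    fix v assume v: "v \<in> verts G"
    have "norm k * norm (f v) \<le> (\<Sum>u\<in>nbhd G v. norm (f u))"
      using norm_sum[of f "nbhd G v"] f(3)[OF v] by (simp add: norm_mult)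
    then show "spectral_radius (adjacency_matrix G vs) * (norm (f v) / M)
        \<le> (\<Sum>u\<in>nbhd G v. norm (f u) / M)"
      using M k(2) by (simp add: sum_divide_distrib[symmetric] divide_right_mono)
    show "norm (f v) / M \<le> 1" using M_ge[OF v] M by simp
  qed (use c M k in auto)
qed

section \<open>The spectral bound and the graphs attaining it\<close>

abbreviation (input) "specrad \<equiv> spectral_radius (adjacency_matrix G vs)"

lemma spectral_triangle_bound:
  assumes "verts G \<noteq> {}"
  shows "(specrad + 1) * (specrad\<^sup>2 - real (card (undirected_edges G))) \<le> 3 * real (card (triangles G))"
proof -
  obtain x c where x: "\<And>v. v \<in> verts G \<Longrightarrow> 0 \<le> x v" "\<And>v. v \<in> verts G \<Longrightarrow> x v \<le> 1"
      "c \<in> verts G" "x c = 1"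
      "\<And>v. v \<in> verts G \<Longrightarrow> specrad * x v \<le> sum x (nbhd G v)" "0 \<le> specrad"
    using obtain_subharmonic[OF assms] by metis
  show ?thesis
  \<comment> \<open>If \<open>specrad\<^sup>2\<close> is below the number of edges, the left side is
    at most 0 and the bound is trivial.\<close>
  proof (cases "real (card (undirected_edges G)) \<le> specrad\<^sup>2")
    case True
    then show ?thesis using card_triangles_ge[of x c specrad] x by blast
  next
    case False
    then have "(specrad + 1) * (specrad\<^sup>2 - real (card (undirected_edges G))) \<le> 0"
      using x(6) by (intro mult_nonneg_nonpos) auto
    then show ?thesis by linarith
  qed
qed

lemma spectral_triangle_bound_eq_imp:
  assumes eq: "(specrad + 1) * (specrad\<^sup>2 - real (card (undirected_edges G))) = 3 * real (card (triangles G))"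
    and no_isolated: "\<And>v. v \<in> verts G \<Longrightarrow> nbhd G v \<noteq> {}"
    and edges: "0 < card (undirected_edges G)"
  shows "is_complete G \<or> is_complete_bipartite G"
proof -
  have "verts G \<noteq> {}"
    using edges dominates_verts by (fastforce simp: undirected_edges_def card_gt_0_iff)
  then obtain x c where x: "\<And>v. v \<in> verts G \<Longrightarrow> 0 \<le> x v" "\<And>v. v \<in> verts G \<Longrightarrow> x v \<le> 1"
      "c \<in> verts G" "x c = 1"
      "\<And>v. v \<in> verts G \<Longrightarrow> specrad * x v \<le> sum x (nbhd G v)" "0 \<le> specrad"
    using obtain_subharmonic by metis
  \<comment> \<open>The triangle count is nonnegative and \<open>specrad + 1\<close> positive, so
    equality itself rules out a negative second factor and \<open>extremal\<close> applies.\<close>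
  have "0 \<le> (specrad + 1) * (specrad\<^sup>2 - real (card (undirected_edges G)))" using eq by simp
  then have "real (card (undirected_edges G)) \<le> specrad\<^sup>2"
    using x(6) by (simp add: zero_le_mult_iff)
  then show ?thesis using extremal[of x c specrad] x eq no_isolated edges by blast
qed

text \<open>There are no triangles, so \<open>specrad\<^sup>2\<close> has to equal the number of
  edges. An explicit eigenfunction gives one direction, \<open>spectral_triangle_bound\<close> with
  triangle count 0 the other.\<close>

lemma complete_bipartite_eq:
  assumes "is_complete_bipartite G"
  shows "(specrad + 1) * (specrad\<^sup>2 - real (card (undirected_edges G))) = 3 * real (card (triangles G))"
proof -
  obtain U V where UV: "verts G = U \<union> V" "U \<inter> V = {}" "card U \<ge> 1" "card V \<ge> 1"
      "arcs_ends G = U \<times> V \<union> V \<times> U"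
    using assms unfolding is_complete_bipartite_def complete_bipartite_digraph_def by blast
  have fin: "finite U" "finite V" using UV(1) finite_verts by (metis finite_Un)+
  obtain u0 where u0: "u0 \<in> U" using UV(3) by fastforce
  have "triangles G = {}"
  proof -
    have False if "T \<in> triangles G" for T
    proof -
      obtain a b c where "T = {a, b, c}" "a \<noteq> b" "a \<noteq> c" "b \<noteq> c"
        using \<open>T \<in> triangles G\<close> by (auto simp: triangles_def card_3_iff)
      then have "a \<rightarrow>\<^bsub>G\<^esub> b" "a \<rightarrow>\<^bsub>G\<^esub> c" "b \<rightarrow>\<^bsub>G\<^esub> c"
        using \<open>T \<in> triangles G\<close> by (auto simp: triangles_def)
      then show False using UV(2,5) by auto
    qed
    then show ?thesis by blast
  qed
  then have t: "card (triangles G) = 0" by simp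
  have "2 * card (undirected_edges G) = card (U \<times> V \<union> V \<times> U)"
    using card_arcs_ends UV(5) by simp
  also have "\<dots> = 2 * (card U * card V)"
    using fin UV(2) by (subst card_Un_disjoint) (auto simp: card_cartesian_product)
  finally have m: "card (undirected_edges G) = card U * card V" by simp
  let ?k = "sqrt (real (card U) * real (card V))"
  \<comment> \<open>The value on each side is the root of the size of the opposite side: at a vertex
    of \<open>U\<close> the neighbourhood sum is \<open>card V * sqrt (card U)\<close>, that is,
    \<open>?k * sqrt (card V)\<close>.\<close>
  let ?f = "\<lambda>v. if v \<in> U then sqrt (real (card V)) else sqrt (real (card U))"
  have "\<bar>?k\<bar> \<le> specrad"
  proof (rule abs_eigenvalue_le_spectral_radius)
    show "u0 \<in> verts G" "?f u0 \<noteq> 0" using u0 UV by auto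
    fix v assume v: "v \<in> verts G"
    show "sum ?f (nbhd G v) = ?k * ?f v"
    proof (cases "v \<in> U")
      case True
      then have "nbhd G v = V" using UV(2,5) by (auto simp: nbhd_def)
      moreover have "sum ?f V = real (card V) * sqrt (real (card U))"
        using UV(2) by (subst sum.cong[of V V _ "\<lambda>_. sqrt (real (card U))"]) auto
      ultimately show ?thesis using True by (simp add: real_sqrt_mult)
    next
      case False
      then have "nbhd G v = U" using UV(1,2,5) v by (auto simp: nbhd_def)
      moreover have "sum ?f U = real (card U) * sqrt (real (card V))" by simp
      ultimately show ?thesis using False by (simp add: real_sqrt_mult)
    qed
  qed
  then have "?k\<^sup>2 \<le> specrad\<^sup>2" by (intro power_mono) auto
  then have ge: "real (card (undirected_edges G)) \<le> specrad\<^sup>2" using m by simp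
  have "0 \<le> specrad" using \<open>\<bar>?k\<bar> \<le> specrad\<close> by linarith
  moreover have "(specrad + 1) * (specrad\<^sup>2 - real (card (undirected_edges G))) \<le> 0"
    using spectral_triangle_bound u0 UV(1) t by auto
  ultimately have "specrad\<^sup>2 = real (card (undirected_edges G))"
    using ge by (simp add: mult_le_0_iff)
  then show ?thesis using t by simp
qed

text \<open>On \<open>n\<close> vertices the spectral radius is \<open>n - 1\<close>, and there are
  \<open>n (n - 1) / 2\<close> edges and \<open>n (n - 1) (n - 2) / 6\<close> triangles; the rest is
  arithmetic.\<close>

lemma complete_eq:
  assumes "is_complete G" "verts G \<noteq> {}"
  shows "(specrad + 1) * (specrad\<^sup>2 - real (card (undirected_edges G))) = 3 * real (card (triangles G))"
proof -
  define n where "n = card (verts G)"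
  have n: "1 \<le> n" using assms(2) finite_verts by (simp add: n_def Suc_le_eq card_gt_0_iff)
  have nb: "nbhd G v = verts G - {v}" if "v \<in> verts G" for v
    using assms(1) that by (auto simp: is_complete_def complete_digraph_def nbhd_def)
  have deg: "card (nbhd G v) = n - 1" if "v \<in> verts G" for v
    using nb[OF that] that finite_verts by (simp add: n_def)
  have "card (arcs_ends G) = n * (n - 1)"
    unfolding arcs_ends_Sigma using finite_nbhd deg by (subst card_SigmaI) (auto simp: n_def)
  then have m: "2 * real (card (undirected_edges G)) = real n * (real n - 1)"
    using card_arcs_ends n by (metis of_nat_1 of_nat_diff of_nat_mult of_nat_numeral)
  have na: "nbhd_arcs G u = Sigma (verts G - {u}) (\<lambda>v. verts G - {u} - {v})" if "u \<in> verts G" for u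
    using that by (auto simp: nbhd_arcs_def arcs_ends_Sigma nb)
  have "card (nbhd_arcs G u) = (n - 1) * (n - 2)" if "u \<in> verts G" for u
    unfolding na[OF that] using that finite_verts
    by (subst card_SigmaI) (auto simp: n_def card_Diff_subset numeral_2_eq_2)
  then have "n * ((n - 1) * (n - 2)) = 6 * card (triangles G)"
    using sum_card_nbhd_arcs by (simp add: n_def)
  \<comment> \<open>For \<open>n = 1\<close> truncated subtraction turns \<open>n - 2\<close> into 0
    instead of -1, but the factor \<open>n - 1\<close> vanishes on both sides.\<close>
  moreover have "real ((n - 1) * (n - 2)) = (real n - 1) * (real n - 2)"
    using n by (cases "n = 1") (auto simp: of_nat_diff)
  ultimately have t: "6 * real (card (triangles G)) = real n * ((real n - 1) * (real n - 2))"
    by (metis of_nat_mult of_nat_numeral)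
  obtain v0 where v0: "v0 \<in> verts G" using assms(2) by blast
  \<comment> \<open>The graph is regular of degree \<open>n - 1\<close>, so constants are
    eigenfunctions.\<close>
  have "\<bar>real n - 1\<bar> \<le> specrad"
    by (rule abs_eigenvalue_le_spectral_radius[of v0 "\<lambda>_. 1"]) (use v0 deg n in \<open>auto simp: of_nat_diff\<close>)
  moreover obtain x c where x: "\<And>v. v \<in> verts G \<Longrightarrow> 0 \<le> x v" "\<And>v. v \<in> verts G \<Longrightarrow> x v \<le> 1"
      "c \<in> verts G" "x c = 1"
      "\<And>v. v \<in> verts G \<Longrightarrow> specrad * x v \<le> sum x (nbhd G v)"
    using obtain_subharmonic[OF assms(2)] by metis
  \<comment> \<open>Subharmonicity at the maximum \<open>c\<close>, with all weights at most 1,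
    bounds the spectral radius by the degree of \<open>c\<close>.\<close>
  have "specrad \<le> real n - 1"
  proof -
    have "specrad \<le> sum x (nbhd G c)" using x(4) x(5)[OF x(3)] by simp
    also have "\<dots> \<le> (\<Sum>u\<in>nbhd G c. 1)" using x(2) nbhd_subset by (intro sum_mono) auto
    finally show ?thesis using deg[OF x(3)] n by (simp add: of_nat_diff)
  qed
  ultimately have r: "specrad = real n - 1" by linarith
  have m': "real (card (undirected_edges G)) = real n * (real n - 1) / 2" using m by simp
  have t': "real (card (triangles G)) = real n * ((real n - 1) * (real n - 2)) / 6" using t by simp
  show ?thesis unfolding r m' t' by (simp add: field_simps power2_eq_square)
qed

end

end

theorem theorem1p7:
  fixes G :: "('a, 'b) pre_digraph" and vs :: "'a list" and m t :: nat and \<rho> :: real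
  assumes "Digraph.graph G"
    and "\<forall>v \<in> verts G. \<not> isolated_vertex G v"
    and "distinct vs" and "set vs = verts G"
    and "m = card (undirected_edges G)" and "m \<ge> 1"
    and "\<rho> = spectral_radius (adjacency_matrix G vs)"
    and "t = card (triangles G)"
  shows "real t \<ge> 1 / 3 * (\<rho> + 1) * (\<rho>\<^sup>2 - real m)
    \<and> (real t = 1 / 3 * (\<rho> + 1) * (\<rho>\<^sup>2 - real m)
        \<longleftrightarrow> is_complete G \<or> is_complete_bipartite G)"
proof -
  interpret Digraph.graph G by fact
  \<comment> \<open>With a vertex present the matrix has positive dimension, so its spectral radius
    is attained by an eigenvalue.\<close>
  have ne: "verts G \<noteq> {}"
    using assms(5,6) dominates_verts by (fastforce simp: undirected_edges_def Suc_le_eq card_gt_0_iff)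
  have no_isolated: "nbhd G v \<noteq> {}" if "v \<in> verts G" for v
    using assms(2) that by (auto simp: isolated_vertex_def nbhd_def)
  have "(\<rho> + 1) * (\<rho>\<^sup>2 - real m) \<le> 3 * real t"
    using spectral_triangle_bound[OF assms(3,4) ne] assms by simp
  moreover have "(\<rho> + 1) * (\<rho>\<^sup>2 - real m) = 3 * real t
      \<longleftrightarrow> is_complete G \<or> is_complete_bipartite G"
    using spectral_triangle_bound_eq_imp[OF assms(3,4) _ no_isolated]
      complete_bipartite_eq[OF assms(3,4)] complete_eq[OF assms(3,4) _ ne] assms(5-8) by auto
  ultimately show ?thesis by (auto simp: field_simps)
qed

end
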